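(* Let $(\mathrm{P},\mathscr{F})$ be one of the pairs $(\mathrm{ICK},\text{all epistemic frames})$, $(\mathrm{ICKT},\text{reflexive frames})$, $(\mathrm{ICKS4},\text{S4 frames})$, $(\mathrm{ICKS5},\text{S5 frames})$. If $\vdash_{\mathrm{P}}\varphi$, then $\varphi$ is valid over $\mathscr{F}$.
   Context: Formulae over a finite non-empty set $\mathsf{A}$ of agents and atoms $\mathrm{Prop}$: $\varphi ::= \bot \mid p \mid \varphi\wedge\varphi\mid\varphi\vee\varphi\mid\varphi\to\varphi\mid K_a\varphi\mid C\varphi$; $\neg\varphi:=\varphi\to\bot$, $E\varphi:=\bigwedge_aK_a\varphi$. Hilbert systems: axiom schemes Int (uniform substitution instances of intuitionistic propositional tautologies), $\mathsf{K}_a$: $K_a(\varphi\to\psi)\to(K_a\varphi\to K_a\psi)$, $\mathsf{K}^c_a$: $(K_a\varphi\to\psi)\to(\neg K_a\varphi\vee\psi)$, $\mathsf{T}_a$: $K_a\varphi\to\varphi$, $\mathsf{S4}_a$: $K_a\varphi\to K_aK_a\varphi$, $\mathsf{S5}_a$: $\neg K_a\varphi\to K_a\neg K_a\varphi$, Fix: $C\varphi\leftrightarrow(\varphi\wedge EC\varphi)$; rules MP, $\mathsf{Nec}_a$ (from $\varphi$ infer $K_a\varphi$), Mon (from $\varphi\to\psi$ infer $C\varphi\to C\psi$), Ind (from $\varphi\to E\varphi$ infer $\varphi\to C\varphi$). $\mathrm{ICK}$: Int, $\mathsf{K}_a$, Fix, all rules; $\mathrm{ICKT}$ adds $\mathsf{T}_a$;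 $\mathrm{ICKS4}$ further adds $\mathsf{S4}_a$; $\mathrm{ICKS5}$ further adds $\mathsf{K}^c_a,\mathsf{S5}_a$. $\vdash_{\mathrm{P}}\varphi$: $\varphi$ has a finite derivation tree from axioms via the rules. Semantics: an epistemic frame $(\mathcal{W},\leq,\{R_a\})$ has $\mathcal{W}\neq\emptyset$, $\leq$ a partial order, $R_a\subseteq\mathcal{W}^2$ with triangle confluence ($w\leq v$, $vR_au$ imply $wR_au$); reflexive/S4/S5 frames have every $R_a$ reflexive / reflexive and transitive / an equivalence relation. Models add a $\leq$-monotone valuation $\mathcal{V}:\mathcal{W}\to\mathcal{P}(\mathrm{Prop})$; $w\models\varphi\to\psi$ iff for all $v\geq w$, $v\models\varphi$ implies $v\models\psi$; $w\models K_a\varphi$ iff all $R_a$-successors satisfy $\varphi$; $w\models C\varphi$ iff all $R^*$-successors satisfy $\varphi$ ($R^*$ the reflexive–transitive closure of $\bigcup_aR_a$); atoms, $\bot,\wedge,\vee$ as usual. Valid over a class = true at every world of every model on a frame of the class. *)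

theory Defs
  imports Main
begin

section \<open>Formulae\<close>

datatype ('a, 'p) fm =
    Bot
  | Atom 'p
  | And "('a, 'p) fm" "('a, 'p) fm"
  | Or "('a, 'p) fm" "('a, 'p) fm"
  | Imp "('a, 'p) fm" "('a, 'p) fm"
  | Know 'a "('a, 'p) fm"
  | Common "('a, 'p) fm"

abbreviation Neg :: "('a, 'p) fm \<Rightarrow> ('a, 'p) fm" where
  "Neg \<phi> \<equiv> Imp \<phi> Bot"

abbreviation Iff :: "('a, 'p) fm \<Rightarrow> ('a, 'p) fm \<Rightarrow> ('a, 'p) fm" where
  "Iff \<phi> \<psi> \<equiv> And (Imp \<phi> \<psi>) (Imp \<psi> \<phi>)"

fun Conj :: "('a, 'p) fm list \<Rightarrow> ('a, 'p) fm" where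
  "Conj [] = Neg Bot"
| "Conj [\<phi>] = \<phi>"
| "Conj (\<phi> # \<psi> # \<phi>s) = And \<phi> (Conj (\<psi> # \<phi>s))"

text \<open>The finite conjunction over all agents is formed along an arbitrary but fixed enumeration
  of the agents, which is never empty.\<close>

definition agents :: "'a::finite list" where
  "agents = (SOME as. distinct as \<and> set as = UNIV)"

definition Everybody :: "('a::finite, 'p) fm \<Rightarrow> ('a, 'p) fm" where
  "Everybody \<phi> = Conj (map (\<lambda>a. Know a \<phi>) agents)"

section \<open>Intuitionistic propositional tautologies\<close>

text \<open>The propositional variables are natural numbers, independently of the atoms of the
  epistemic language, so that schemes with any number of metavariables are available.\<close>

datatype pfm =
    PBot
  | PVar nat
  | PAnd pfm pfm
  | POr pfm pfm
  | PImp pfm pfm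

text \<open>Tautologies are the theorems of the Hilbert calculus for intuitionistic propositional
  logic.\<close>

inductive int_taut :: "pfm \<Rightarrow> bool" where
  "int_taut (PImp A (PImp B A))"
| "int_taut (PImp (PImp A (PImp B C)) (PImp (PImp A B) (PImp A C)))"
| "int_taut (PImp (PAnd A B) A)"
| "int_taut (PImp (PAnd A B) B)"
| "int_taut (PImp A (PImp B (PAnd A B)))"
| "int_taut (PImp A (POr A B))"
| "int_taut (PImp B (POr A B))"
| "int_taut (PImp (PImp A C) (PImp (PImp B C) (PImp (POr A B) C)))"
| "int_taut (PImp PBot A)"
| "int_taut (PImp A B) \<Longrightarrow> int_taut A \<Longrightarrow> int_taut B"

primrec psubst :: "(nat \<Rightarrow> ('a, 'p) fm) \<Rightarrow> pfm \<Rightarrow> ('a, 'p) fm" where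
  "psubst \<sigma> PBot = Bot"
| "psubst \<sigma> (PVar n) = \<sigma> n"
| "psubst \<sigma> (PAnd A B) = And (psubst \<sigma> A) (psubst \<sigma> B)"
| "psubst \<sigma> (POr A B) = Or (psubst \<sigma> A) (psubst \<sigma> B)"
| "psubst \<sigma> (PImp A B) = Imp (psubst \<sigma> A) (psubst \<sigma> B)"

section \<open>Hilbert systems\<close>

definition Ax_Int :: "('a, 'p) fm set" where
  "Ax_Int = {psubst \<sigma> A | \<sigma> A. int_taut A}"

definition Ax_K :: "('a, 'p) fm set" where
  "Ax_K = {Imp (Know a (Imp \<phi> \<psi>)) (Imp (Know a \<phi>) (Know a \<psi>)) | a \<phi> \<psi>. True}"

definition Ax_Kc :: "('a, 'p) fm set" where
  "Ax_Kc = {Imp (Imp (Know a \<phi>) \<psi>) (Or (Neg (Know a \<phi>)) \<psi>) | a \<phi> \<psi>. True}"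

definition Ax_T :: "('a, 'p) fm set" where
  "Ax_T = {Imp (Know a \<phi>) \<phi> | a \<phi>. True}"

definition Ax_S4 :: "('a, 'p) fm set" where
  "Ax_S4 = {Imp (Know a \<phi>) (Know a (Know a \<phi>)) | a \<phi>. True}"

definition Ax_S5 :: "('a, 'p) fm set" where
  "Ax_S5 = {Imp (Neg (Know a \<phi>)) (Know a (Neg (Know a \<phi>))) | a \<phi>. True}"

definition Ax_Fix :: "('a::finite, 'p) fm set" where
  "Ax_Fix = {Iff (Common \<phi>) (And \<phi> (Everybody (Common \<phi>))) | \<phi>. True}"

text \<open>The four systems share their rules, so each is identified with its set of axioms.\<close>

definition ICK :: "('a::finite, 'p) fm set" where
  "ICK = Ax_Int \<union> Ax_K \<union> Ax_Fix"

definition ICKT :: "('a::finite, 'p) fm set" where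
  "ICKT = ICK \<union> Ax_T"

definition ICKS4 :: "('a::finite, 'p) fm set" where
  "ICKS4 = ICKT \<union> Ax_S4"

definition ICKS5 :: "('a::finite, 'p) fm set" where
  "ICKS5 = ICKS4 \<union> Ax_Kc \<union> Ax_S5"

inductive derivable :: "('a::finite, 'p) fm set \<Rightarrow> ('a, 'p) fm \<Rightarrow> bool"
  (infix \<open>\<turnstile>\<close> 50) for P where
  Axiom: "\<phi> \<in> P \<Longrightarrow> P \<turnstile> \<phi>"
| MP: "P \<turnstile> Imp \<phi> \<psi> \<Longrightarrow> P \<turnstile> \<phi> \<Longrightarrow> P \<turnstile> \<psi>"
| Nec: "P \<turnstile> \<phi> \<Longrightarrow> P \<turnstile> Know a \<phi>"
| Mon: "P \<turnstile> Imp \<phi> \<psi> \<Longrightarrow> P \<turnstile> Imp (Common \<phi>) (Common \<psi>)"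
| Ind: "P \<turnstile> Imp \<phi> (Everybody \<phi>) \<Longrightarrow> P \<turnstile> Imp \<phi> (Common \<phi>)"

section \<open>Frames, models and validity\<close>

record ('w, 'a) frame =
  Worlds :: "'w set"
  Leq :: "('w \<times> 'w) set"
  Acc :: "'a \<Rightarrow> ('w \<times> 'w) set"

definition epistemic_frames :: "('w, 'a) frame set" where
  "epistemic_frames = {F. Worlds F \<noteq> {} \<and>
     partial_order_on (Worlds F) (Leq F) \<and>
     (\<forall>a. Acc F a \<subseteq> Worlds F \<times> Worlds F) \<and>
     (\<forall>a w v u. (w, v) \<in> Leq F \<longrightarrow> (v, u) \<in> Acc F a \<longrightarrow> (w, u) \<in> Acc F a)}"

definition reflexive_frames :: "('w, 'a) frame set" where
  "reflexive_frames = {F \<in> epistemic_frames. \<forall>a. refl_on (Worlds F) (Acc F a)}"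

definition S4_frames :: "('w, 'a) frame set" where
  "S4_frames = {F \<in> epistemic_frames. \<forall>a. refl_on (Worlds F) (Acc F a) \<and> trans (Acc F a)}"

definition S5_frames :: "('w, 'a) frame set" where
  "S5_frames = {F \<in> epistemic_frames. \<forall>a. equiv (Worlds F) (Acc F a)}"

definition is_valuation :: "('w, 'a) frame \<Rightarrow> ('w \<Rightarrow> 'p set) \<Rightarrow> bool" where
  "is_valuation F V \<longleftrightarrow> (\<forall>w v. (w, v) \<in> Leq F \<longrightarrow> V w \<subseteq> V v)"

primrec satisfies :: "('w, 'a) frame \<Rightarrow> ('w \<Rightarrow> 'p set) \<Rightarrow> 'w \<Rightarrow> ('a, 'p) fm \<Rightarrow> bool" where
  "satisfies F V w Bot \<longleftrightarrow> False"
| "satisfies F V w (Atom p) \<longleftrightarrow> p \<in> V w"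
| "satisfies F V w (And \<phi> \<psi>) \<longleftrightarrow> satisfies F V w \<phi> \<and> satisfies F V w \<psi>"
| "satisfies F V w (Or \<phi> \<psi>) \<longleftrightarrow> satisfies F V w \<phi> \<or> satisfies F V w \<psi>"
| "satisfies F V w (Imp \<phi> \<psi>) \<longleftrightarrow>
     (\<forall>v. (w, v) \<in> Leq F \<longrightarrow> satisfies F V v \<phi> \<longrightarrow> satisfies F V v \<psi>)"
| "satisfies F V w (Know a \<phi>) \<longleftrightarrow> (\<forall>v. (w, v) \<in> Acc F a \<longrightarrow> satisfies F V v \<phi>)"
| "satisfies F V w (Common \<phi>) \<longleftrightarrow> (\<forall>v. (w, v) \<in> (\<Union>a. Acc F a)\<^sup>* \<longrightarrow> satisfies F V v \<phi>)"

definition valid_over :: "('w, 'a) frame set \<Rightarrow> ('a, 'p) fm \<Rightarrow> bool" where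
  "valid_over \<F> \<phi> \<longleftrightarrow>
     (\<forall>F \<in> \<F>. \<forall>V. is_valuation F V \<longrightarrow> (\<forall>w \<in> Worlds F. satisfies F V w \<phi>))"

end

(* Soundness is by induction on derivations. Triangle confluence makes truth persistent along the
   partial order, which is what the axioms of intuitionistic logic need; the induction rule for
   common knowledge is an induction along paths of the union of the accessibility relations. On S5
   frames reflexivity and confluence put the partial order inside every accessibility relation, so
   knowledge is constant along it and behaves classically there. *)

theory Submission
  imports Defs
begin

lemma satisfies_Conj:
  assumes "(w, w) \<in> Leq F"
  shows "satisfies F V w (Conj \<phi>s) \<longleftrightarrow> (\<forall>\<phi> \<in> set \<phi>s. satisfies F V w \<phi>)"
  using assms by (induction \<phi>s rule: Conj.induct) auto

lemma set_agents: "set (agents :: 'a::finite list) = UNIV"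
proof -
  obtain as :: "'a list" where "set as = UNIV \<and> distinct as"
    using finite_distinct_list[OF finite] by blast
  then have "\<exists>as :: 'a list. distinct as \<and> set as = UNIV" by blast
  then show ?thesis
    unfolding agents_def by (rule someI2_ex) simp
qed

text \<open>Reads \<open>Everybody\<close> as the box of the union relation, whose
  reflexive-transitive closure interprets \<open>Common\<close>; this turns Fix and Ind into
  statements about paths.\<close>

lemma satisfies_Everybody:
  assumes "(w, w) \<in> Leq F"
  shows "satisfies F V w (Everybody \<phi>) \<longleftrightarrow> (\<forall>v. (w, v) \<in> (\<Union>a. Acc F a) \<longrightarrow> satisfies F V v \<phi>)"
  by (auto simp: Everybody_def satisfies_Conj[of w F] assms set_agents)

locale epistemic_model =
  fixes F :: "('w, 'a::finite) frame" and V :: "'w \<Rightarrow> 'p set"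
  assumes epistemic: "F \<in> epistemic_frames" and valuation: "is_valuation F V"
begin

lemma Leq_Worlds: "(w, v) \<in> Leq F \<Longrightarrow> w \<in> Worlds F \<and> v \<in> Worlds F"
  using epistemic
  by (auto simp: epistemic_frames_def partial_order_on_def preorder_on_def)

lemma Leq_refl: "w \<in> Worlds F \<Longrightarrow> (w, w) \<in> Leq F"
  using epistemic
  by (auto simp: epistemic_frames_def partial_order_on_def preorder_on_def refl_on_def)

lemma Leq_trans: "(w, v) \<in> Leq F \<Longrightarrow> (v, u) \<in> Leq F \<Longrightarrow> (w, u) \<in> Leq F"
  using epistemic
  by (auto simp: epistemic_frames_def partial_order_on_def preorder_on_def dest: transD)

lemma Acc_Worlds: "(w, v) \<in> Acc F a \<Longrightarrow> w \<in> Worlds F \<and> v \<in> Worlds F"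
  using epistemic by (auto simp: epistemic_frames_def)

lemma confluence: "(w, v) \<in> Leq F \<Longrightarrow> (v, u) \<in> Acc F a \<Longrightarrow> (w, u) \<in> Acc F a"
  using epistemic by (auto simp: epistemic_frames_def)

lemma rtrancl_Acc_Worlds:
  assumes "(w, v) \<in> (\<Union>a. Acc F a)\<^sup>*" and "w \<in> Worlds F"
  shows "v \<in> Worlds F"
  using assms by (induction rule: rtrancl_induct) (auto dest: Acc_Worlds)

lemma satisfies_mono:
  assumes "(w, v) \<in> Leq F" and "satisfies F V w \<phi>"
  shows "satisfies F V v \<phi>"
  using assms
proof (induction \<phi> arbitrary: w v)
  case (Atom p)
  then show ?case using valuation by (auto simp: is_valuation_def)
next
  case (Imp \<phi> \<psi>)
  then show ?case by (auto dest: Leq_trans)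
next
  case (Know a \<phi>)
  then show ?case by (auto dest: confluence)
next
  case (Common \<phi>)
  have "satisfies F V u \<phi>" if "(v, u) \<in> (\<Union>a. Acc F a)\<^sup>*" for u
    using that
  proof (cases rule: converse_rtranclE)
    case base
    then show ?thesis using Common by auto
  next
    case (step x)
    \<comment> \<open>Confluence moves the start of the first step down from \<open>v\<close> to
      \<open>w\<close>; the rest of the path is kept.\<close>
    then have "(w, x) \<in> (\<Union>a. Acc F a)" using Common.prems(1) by (auto dest: confluence)
    then have "(w, u) \<in> (\<Union>a. Acc F a)\<^sup>*" using step(2) by (rule converse_rtrancl_into_rtrancl)
    then show ?thesis using Common.prems(2) by simp
  qed
  then show ?case by simp
qed auto

lemma satisfies_Imp_self:
  "satisfies F V w (Imp \<phi> \<psi>) \<Longrightarrow> satisfies F V w \<phi> \<Longrightarrow> w \<in> Worlds F \<Longrightarrow> satisfies F V w \<psi>"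
  by (auto dest: Leq_refl)

text \<open>In nested implications each further premise is met at a larger world, and persistence
  keeps the earlier ones true there. Modus ponens is case 10.\<close>

lemma int_taut_sound:
  assumes "int_taut A" and "w \<in> Worlds F"
  shows "satisfies F V w (psubst \<sigma> A)"
  using assms
proof (induction arbitrary: w)
  case (10 A B)
  then show ?case using satisfies_Imp_self by (metis psubst.simps(5))
qed (auto, (meson Leq_Worlds Leq_refl Leq_trans satisfies_mono)+)

text \<open>By confluence, a successor of the world where the inner premise holds is also a
  successor of the smaller world where the implication is known. The implication is then applied at
  that successor itself.\<close>

lemma Ax_K_sound: "\<phi> \<in> Ax_K \<Longrightarrow> satisfies F V w \<phi>"
  by (auto simp: Ax_K_def) (meson Acc_Worlds Leq_refl confluence)

text \<open>A path is either trivial or one step followed by a path.\<close>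

lemma satisfies_Common_unfold:
  assumes "w \<in> Worlds F"
  shows "satisfies F V w (Common \<phi>) \<longleftrightarrow> satisfies F V w (And \<phi> (Everybody (Common \<phi>)))"
  using satisfies_Everybody[OF Leq_refl[OF assms], of V "Common \<phi>"]
  by (auto intro: converse_rtrancl_into_rtrancl) (erule converse_rtranclE; auto)

lemma Ax_Fix_sound:
  assumes "\<phi> \<in> Ax_Fix"
  shows "satisfies F V w \<phi>"
proof -
  obtain \<chi> where \<phi>: "\<phi> = Iff (Common \<chi>) (And \<chi> (Everybody (Common \<chi>)))"
    using assms by (auto simp: Ax_Fix_def)
  have "satisfies F V v (Common \<chi>) \<longleftrightarrow> satisfies F V v (And \<chi> (Everybody (Common \<chi>)))"
    if "(w, v) \<in> Leq F" for v
    using that Leq_Worlds satisfies_Common_unfold by blast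
  then show ?thesis
    \<comment> \<open>Only the outer conjunction and its two implications are unfolded, so that the
      equivalence above still matches.\<close>
    unfolding \<phi> by (subst satisfies.simps(3), subst (1 2) satisfies.simps(5)) blast
qed

lemma Ax_T_sound:
  assumes "\<And>a. refl_on (Worlds F) (Acc F a)" and "\<phi> \<in> Ax_T"
  shows "satisfies F V w \<phi>"
  using assms by (auto simp: Ax_T_def) (meson Leq_Worlds refl_onD)

lemma Ax_S4_sound:
  assumes "\<And>a. trans (Acc F a)" and "\<phi> \<in> Ax_S4"
  shows "satisfies F V w \<phi>"
  using assms by (auto simp: Ax_S4_def) (meson transD)

lemma satisfies_Know_Acc:
  assumes "equiv (Worlds F) (Acc F a)" and "(w, v) \<in> Acc F a"
  shows "satisfies F V w (Know a \<phi>) \<longleftrightarrow> satisfies F V v (Know a \<phi>)"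
  using assms by (auto simp: equiv_def dest: symD transD)

text \<open>Confluence is applied to \<open>w\<close> below \<open>v\<close> and the loop at
  \<open>v\<close>.\<close>

lemma Leq_subset_Acc:
  assumes "refl_on (Worlds F) (Acc F a)" and "(w, v) \<in> Leq F"
  shows "(w, v) \<in> Acc F a"
  using assms by (auto dest: Leq_Worlds refl_onD intro: confluence)

lemma satisfies_Know_Leq:
  assumes "equiv (Worlds F) (Acc F a)" and "(w, v) \<in> Leq F"
  shows "satisfies F V w (Know a \<phi>) \<longleftrightarrow> satisfies F V v (Know a \<phi>)"
  using assms by (intro satisfies_Know_Acc Leq_subset_Acc) (auto simp: equiv_def)

text \<open>Negation quantifies over all larger worlds, but these agree with \<open>w\<close> on
  what \<open>a\<close> knows.\<close>

lemma satisfies_Neg_Know: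
  assumes "equiv (Worlds F) (Acc F a)" and "w \<in> Worlds F"
  shows "satisfies F V w (Neg (Know a \<phi>)) \<longleftrightarrow> \<not> satisfies F V w (Know a \<phi>)"
  using satisfies_Know_Leq[OF assms(1)] Leq_refl[OF assms(2)] by (metis satisfies.simps(1,5))

lemma Ax_Kc_sound:
  assumes "\<And>a. equiv (Worlds F) (Acc F a)" and "\<phi> \<in> Ax_Kc"
  shows "satisfies F V w \<phi>"
proof -
  obtain a \<chi> \<psi> where \<phi>: "\<phi> = Imp (Imp (Know a \<chi>) \<psi>) (Or (Neg (Know a \<chi>)) \<psi>)"
    using assms(2) by (auto simp: Ax_Kc_def)
  \<comment> \<open>Classical case split on \<open>Know a \<chi>\<close> at \<open>v\<close>: if it
    holds, the implication applied at \<open>v\<close> gives \<open>\<psi>\<close>; otherwise its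
    negation holds.\<close>
  have "satisfies F V v (Or (Neg (Know a \<chi>)) \<psi>)"
    if "(w, v) \<in> Leq F" "satisfies F V v (Imp (Know a \<chi>) \<psi>)" for v
    using that satisfies_Imp_self satisfies_Neg_Know[OF assms(1)] Leq_Worlds
    by (metis satisfies.simps(4))
  then show ?thesis unfolding \<phi> by (subst satisfies.simps(5)) blast
qed

lemma Ax_S5_sound:
  assumes "\<And>a. equiv (Worlds F) (Acc F a)" and "\<phi> \<in> Ax_S5"
  shows "satisfies F V w \<phi>"
proof -
  obtain a \<chi> where \<phi>: "\<phi> = Imp (Neg (Know a \<chi>)) (Know a (Neg (Know a \<chi>)))"
    using assms(2) by (auto simp: Ax_S5_def)
  \<comment> \<open>Failure of \<open>Know a \<chi>\<close> passes to every successor, since related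
    worlds lie in one equivalence class.\<close>
  have "satisfies F V v (Know a (Neg (Know a \<chi>)))"
    if "(w, v) \<in> Leq F" "satisfies F V v (Neg (Know a \<chi>))" for v
    using that satisfies_Neg_Know[OF assms(1)] satisfies_Know_Acc[OF assms(1)] Leq_Worlds Acc_Worlds
    by (metis satisfies.simps(6))
  then show ?thesis unfolding \<phi> by (subst satisfies.simps(5)) blast
qed

lemma ICK_sound: "\<phi> \<in> ICK \<Longrightarrow> w \<in> Worlds F \<Longrightarrow> satisfies F V w \<phi>"
  by (auto simp: ICK_def Ax_Int_def int_taut_sound Ax_K_sound Ax_Fix_sound)

text \<open>One induction serves all four systems, as they differ only in their axioms. The world is
  generalized because the modal rules use their premise at other worlds.\<close>

lemma derivable_sound:
  assumes "P \<turnstile> \<phi>" and "\<And>w \<psi>. \<psi> \<in> P \<Longrightarrow> w \<in> Worlds F \<Longrightarrow> satisfies F V w \<psi>"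
    and "w \<in> Worlds F"
  shows "satisfies F V w \<phi>"
  using assms(1,3)
proof (induction arbitrary: w)
  case (Axiom \<phi>)
  then show ?case using assms(2) by blast
next
  case (MP \<phi> \<psi>)
  then show ?case using satisfies_Imp_self by blast
next
  case (Nec \<phi> a)
  then show ?case by (auto dest: Acc_Worlds)
next
  case (Mon \<phi> \<psi>)
  then show ?case
    using satisfies_Imp_self rtrancl_Acc_Worlds Leq_Worlds
    by (metis satisfies.simps(5,7))
next
  case (Ind \<phi>)
  \<comment> \<open>Along a path, truth of \<open>\<phi>\<close> at one world gives
    \<open>Everybody \<phi>\<close> there by the premise of the rule, hence \<open>\<phi>\<close> at
    the next world.\<close>
  have "satisfies F V u \<phi>"
    if "(v, u) \<in> (\<Union>a. Acc F a)\<^sup>*" "v \<in> Worlds F" "satisfies F V v \<phi>" for v u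
    using that
  proof (induction rule: rtrancl_induct)
    case (step x y)
    have "x \<in> Worlds F" using step rtrancl_Acc_Worlds by blast
    then have "satisfies F V x (Everybody \<phi>)"
      using Ind.IH satisfies_Imp_self step by blast
    then show ?case
      using satisfies_Everybody[OF Leq_refl[OF \<open>x \<in> Worlds F\<close>]] step(2) by blast
  qed
  then show ?case by (auto dest: Leq_Worlds)
qed

end

theorem mainTheorem7:
  fixes P :: "('a::finite, 'p) fm set"
    and \<F> :: "('w, 'a) frame set"
    and \<phi> :: "('a, 'p) fm"
  assumes "(P, \<F>) \<in> {(ICK, epistemic_frames), (ICKT, reflexive_frames),
                      (ICKS4, S4_frames), (ICKS5, S5_frames)}"
    and "P \<turnstile> \<phi>"
  shows "valid_over \<F> \<phi>"
  unfolding valid_over_def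
proof (intro ballI allI impI)
  fix F :: "('w, 'a) frame" and V :: "'w \<Rightarrow> 'p set" and w
  assume F: "F \<in> \<F>" and V: "is_valuation F V" and w: "w \<in> Worlds F"
  have "F \<in> epistemic_frames"
    using assms(1) F by (auto simp: reflexive_frames_def S4_frames_def S5_frames_def)
  then interpret epistemic_model F V using V by unfold_locales
  have "satisfies F V v \<psi>" if "\<psi> \<in> P" "v \<in> Worlds F" for v \<psi>
    using assms(1) F that
    by (auto simp: reflexive_frames_def S4_frames_def S5_frames_def equiv_def
        ICKT_def ICKS4_def ICKS5_def
        intro: ICK_sound Ax_T_sound Ax_S4_sound Ax_Kc_sound Ax_S5_sound)
  then show "satisfies F V w \<phi>" using derivable_sound assms(2) w by blast
qed

end
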